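(* Let $k\ge 1$ and $n\ge 1$ be integers. Let $A_n=\left(\binom{2i+1}{i-j}\right)_{i,j=0}^{n-1}$ and let $\gamma^{(k)}_n$ be the $n\times n$ matrix (rows and columns indexed by $0,\dots,n-1$) whose $(i,j)$ entry is $1$ if $|i-j|=k$ or $i+j=k-1$, and $0$ otherwise. Then $$A_n\gamma^{(k)}_nA_n^\top=\left(\binom{2i+2j+2}{i+j+1-k}\right)_{i,j=0}^{n-1}.$$
   Context: Binomial coefficients $\binom{a}{b}$ with integer $b<0$ or $b>a$ are $0$. *)

theory Defs
  imports "Jordan_Normal_Form.Matrix"
begin

text \<open>Binomial coefficient with an integer lower index: it vanishes if the lower index is negative
  (and, by the library convention for \<^const>\<open>binomial\<close>, if it exceeds the upper index). Lower indices
  such as \<open>i - j\<close> must be formed in \<^typ>\<open>int\<close>, as subtraction on \<^typ>\<open>nat\<close> would truncate them to 0.\<close>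

definition ibinom :: "nat \<Rightarrow> int \<Rightarrow> int" where
  "ibinom a b = (if b < 0 then 0 else int (a choose nat b))"

definition A_mat :: "nat \<Rightarrow> int mat" where
  "A_mat n = mat n n (\<lambda>(i, j). ibinom (2 * i + 1) (int i - int j))"

definition gamma_mat :: "nat \<Rightarrow> nat \<Rightarrow> int mat" where
  "gamma_mat k n = mat n n (\<lambda>(i, j).
     if \<bar>int i - int j\<bar> = int k \<or> int i + int j = int k - 1 then 1 else 0)"

end

theory Submission imports Defs begin

text \<open>Write \<open>f\<^sub>i(l) = ibinom (2 * i + 1) (i - l)\<close> for every integer \<open>l\<close>; then \<open>f\<^sub>i(-1 - l) = f\<^sub>i(l)\<close>.
  Folding the integers onto the naturals by the reflection \<open>l \<mapsto> -1 - l\<close> turns the shift by \<open>k\<close> into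
  the matrix \<open>gamma_mat k\<close>: its row \<open>l\<close> sends \<open>f\<^sub>j\<close> to \<open>f\<^sub>j(l - k) + f\<^sub>j(l + k)\<close>, the condition
  \<open>l + m = k - 1\<close> recording the reflected terms. Unfolding in the same way, the \<open>(i, j)\<close> entry
  of the triple product becomes the sum of \<open>f\<^sub>i(l) * f\<^sub>j(l - k)\<close> over all integers \<open>l\<close>, which is
  Vandermonde's convolution.\<close>

lemma ibinom_eq_0: "b < 0 \<or> b > int a \<Longrightarrow> ibinom a b = 0"
  by (auto simp: ibinom_def binomial_eq_0)

lemma ibinom_symmetric: "ibinom a (int a - b) = ibinom a b"
proof (cases "0 \<le> b \<and> b \<le> int a")
  case True
  then have "nat (int a - b) = a - nat b" "nat b \<le> a" by auto
  with True show ?thesis by (simp add: ibinom_def binomial_symmetric[of "nat b" a])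
next
  case False
  then show ?thesis by (auto simp: ibinom_eq_0)
qed

lemma sum_of_nat_int: "(\<Sum>m\<in>{0..<n}. h (int m)) = (\<Sum>m\<in>{0..<int n}. h m)"
  by (simp add: sum.reindex flip: image_int_atLeastLessThan[of 0 n, simplified])

text \<open>The first factor vanishes off \<open>{0..int a}\<close>, so any finite \<open>S\<close>
  containing that interval gives the full convolution over the integers.\<close>

lemma ibinom_vandermonde:
  assumes "finite S" and "{0..int a} \<subseteq> S"
  shows "(\<Sum>p\<in>S. ibinom a p * ibinom b (r - p)) = ibinom (a + b) r"
proof (cases "r < 0")
  case True
  then have "ibinom a p * ibinom b (r - p) = 0" for p
    by (cases "p < 0") (auto simp: ibinom_eq_0)
  then have "(\<Sum>p\<in>S. ibinom a p * ibinom b (r - p)) = 0" by (intro sum.neutral ballI)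
  with True show ?thesis by (simp add: ibinom_eq_0)
next
  case False
  define s where "s = nat r"
  have r: "r = int s" using False by (simp add: s_def)
  have nz: "0 \<le> p \<and> p \<le> int c" if "ibinom c p \<noteq> 0" for c p
    using that ibinom_eq_0[of p c] by linarith
  let ?h = "\<lambda>p. ibinom a p * ibinom b (r - p)"
  let ?T = "{0..<int (Suc s)}"
  \<comment> \<open>Neither of \<open>S\<close> and \<open>?T\<close> need contain the other, hence
    the detour via the intersection: off \<open>?T\<close> one of the factors has a negative lower
    index, off \<open>S\<close> the first factor is zero.\<close>
  have "sum ?h S = sum ?h (S \<inter> ?T)"
    using assms(1) by (intro sum.mono_neutral_right) (auto simp: r dest!: nz)
  also have "\<dots> = sum ?h ?T"
    using assms by (intro sum.mono_neutral_left) (auto simp: subset_iff dest!: nz)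
  also have "\<dots> = (\<Sum>p\<in>{0..<Suc s}. ?h (int p))"
    by (rule sum_of_nat_int[symmetric])
  also have "\<dots> = (\<Sum>p\<le>s. int ((a choose p) * (b choose (s - p))))"
    by (intro sum.cong) (auto simp: ibinom_def r nat_diff_distrib)
  also have "\<dots> = ibinom (a + b) r"
    by (simp add: ibinom_def r vandermonde flip: of_nat_sum of_nat_mult)
  finally show ?thesis .
qed

lemma gamma_row_sum:
  fixes g :: "int \<Rightarrow> int"
  assumes "k \<ge> 1" and "l \<ge> 0"
    and refl: "\<And>m. g (- 1 - m) = g m"
    and supp: "\<And>m. m \<ge> int n \<Longrightarrow> g m = 0"
  shows "(\<Sum>m\<in>{0..<int n}. (if \<bar>l - m\<bar> = int k \<or> l + m = int k - 1 then 1 else 0) * g m)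
       = g (l - int k) + g (l + int k)"
proof -
  \<comment> \<open>No double counting: \<open>l - k\<close> and \<open>k - 1 - l\<close> have odd
    sum, and \<open>l + k\<close> exceeds both as \<open>k \<ge> 1\<close> and
    \<open>l \<ge> 0\<close>.\<close>
  have "(\<Sum>m\<in>{0..<int n}. (if \<bar>l - m\<bar> = int k \<or> l + m = int k - 1 then 1 else 0) * g m)
      = (\<Sum>m\<in>{0..<int n}. (if m = l - int k then g m else 0)
          + (if m = int k - 1 - l then g m else 0) + (if m = l + int k then g m else 0))"
    using assms(1,2) by (intro sum.cong) (auto simp: abs_if)
  also have "\<dots> = (if l - int k \<in> {0..<int n} then g (l - int k) else 0)
      + (if int k - 1 - l \<in> {0..<int n} then g (int k - 1 - l) else 0)
      + (if l + int k \<in> {0..<int n} then g (l + int k) else 0)"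
    by (simp add: sum.distrib)
  \<comment> \<open>Exactly one of the mirror points \<open>l - k\<close> and
    \<open>k - 1 - l\<close> is nonnegative, so together they yield \<open>g (l - k)\<close> once;
    points beyond the range contribute 0 by \<open>supp\<close>.\<close>
  also have "\<dots> = g (l - int k) + g (l + int k)"
    using refl[of "l - int k"] supp[of "l - int k"] supp[of "int k - 1 - l"] supp[of "l + int k"]
      assms(1,2) by (auto simp: algebra_simps)
  finally show ?thesis .
qed

lemma sum_reflect_int:
  fixes h :: "int \<Rightarrow> 'a::comm_monoid_add"
  shows "(\<Sum>l\<in>{0..<n}. h (- 1 - l)) = (\<Sum>l\<in>{- n..<0}. h l)"
  by (rule sum.reindex_bij_witness[of _ "\<lambda>l. - 1 - l" "\<lambda>l. - 1 - l"]) auto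

lemma gamma_convolution:
  assumes "k \<ge> 1" and "i < n" and "j < n"
  shows "(\<Sum>l\<in>{0..<int n}. ibinom (2 * i + 1) (int i - l) *
           (\<Sum>m\<in>{0..<int n}. (if \<bar>l - m\<bar> = int k \<or> l + m = int k - 1 then 1 else 0)
              * ibinom (2 * j + 1) (int j - m)))
       = ibinom (2 * i + 2 * j + 2) (int i + int j + 1 - int k)"
    (is "?lhs = _")
proof -
  define f g where "f l = ibinom (2 * i + 1) (int i - l)"
    and "g l = ibinom (2 * j + 1) (int j - l)" for l
  have f_refl: "f (- 1 - l) = f l" and g_refl: "g (- 1 - l) = g l" for l
    using ibinom_symmetric[of "2 * i + 1" "int i - l"] ibinom_symmetric[of "2 * j + 1" "int j - l"]
    by (simp_all add: f_def g_def algebra_simps)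
  have g_supp: "g m = 0" if "m \<ge> int n" for m
    using that assms(3) by (simp add: g_def ibinom_eq_0)
  have "?lhs = (\<Sum>l\<in>{0..<int n}. f l * (g (l - int k) + g (l + int k)))"
    using gamma_row_sum[where g = g and n = n, OF assms(1) _ g_refl g_supp]
    by (intro sum.cong) (auto simp: f_def g_def)
  \<comment> \<open>Reflecting both factors of \<open>f l * g (l + k)\<close> makes it the first
    summand taken at \<open>- 1 - l\<close>.\<close>
  also have "\<dots> = (\<Sum>l\<in>{0..<int n}. f l * g (l - int k))
      + (\<Sum>l\<in>{0..<int n}. f (- 1 - l) * g (- 1 - l - int k))"
  proof -
    have "g (- 1 - l - int k) = g (l + int k)" for l
      using g_refl[of "l + int k"] by (simp add: algebra_simps)
    then show ?thesis by (simp add: f_refl distrib_left sum.distrib)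
  qed
  also have "\<dots> = (\<Sum>l\<in>{0..<int n}. f l * g (l - int k)) + (\<Sum>l\<in>{- int n..<0}. f l * g (l - int k))"
    by (simp only: sum_reflect_int[of "\<lambda>l. f l * g (l - int k)"])
  also have "\<dots> = (\<Sum>l\<in>{- int n..<int n}. f l * g (l - int k))"
  proof -
    have "{- int n..<int n} = {0..<int n} \<union> {- int n..<0}" by auto
    then show ?thesis by (simp add: sum.union_disjoint)
  qed
  \<comment> \<open>Substitute \<open>p = i - l\<close> and reflect \<open>g\<close>, so that the
    two lower indices have a constant sum.\<close>
  also have "\<dots> = (\<Sum>p\<in>{int i - int n<..int i + int n}.
      ibinom (2 * i + 1) p * ibinom (2 * j + 1) (int i + int j + 1 - int k - p))"
  proof (rule sum.reindex_bij_witness[of _ "\<lambda>p. int i - p" "\<lambda>l. int i - l"])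
    fix l
    show "ibinom (2 * i + 1) (int i - l)
          * ibinom (2 * j + 1) (int i + int j + 1 - int k - (int i - l)) = f l * g (l - int k)"
      using g_refl[of "l - int k"] by (simp add: f_def g_def algebra_simps)
  qed auto
  \<comment> \<open>Since \<open>i < n\<close>, the range of \<open>p\<close> contains
    \<open>{0..2 * i + 1}\<close>: cutting off at \<open>n\<close> loses nothing.\<close>
  also have "\<dots> = ibinom ((2 * i + 1) + (2 * j + 1)) (int i + int j + 1 - int k)"
    using assms by (intro ibinom_vandermonde) auto
  finally show ?thesis by simp
qed

theorem theorem4p2:
  fixes k n :: nat
  assumes "k \<ge> 1" and "n \<ge> 1"
  shows "A_mat n * gamma_mat k n * transpose_mat (A_mat n)
       = mat n n (\<lambda>(i, j). ibinom (2 * i + 2 * j + 2) (int i + int j + 1 - int k))"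
proof -
  have dims: "A_mat n \<in> carrier_mat n n" "gamma_mat k n \<in> carrier_mat n n"
    "transpose_mat (A_mat n) \<in> carrier_mat n n"
    by (simp_all add: A_mat_def gamma_mat_def)
  have "(A_mat n * (gamma_mat k n * transpose_mat (A_mat n))) $$ (i, j)
      = ibinom (2 * i + 2 * j + 2) (int i + int j + 1 - int k)" if "i < n" "j < n" for i j
  proof -
    have "(A_mat n * (gamma_mat k n * transpose_mat (A_mat n))) $$ (i, j)
        = (\<Sum>l\<in>{0..<n}. ibinom (2 * i + 1) (int i - int l) *
           (\<Sum>m\<in>{0..<n}. (if \<bar>int l - int m\<bar> = int k \<or> int l + int m = int k - 1 then 1 else 0)
              * ibinom (2 * j + 1) (int j - int m)))"
      using that by (simp add: A_mat_def gamma_mat_def scalar_prod_def)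
    also have "\<dots> = ibinom (2 * i + 2 * j + 2) (int i + int j + 1 - int k)"
      using gamma_convolution[OF assms(1) that] by (simp only: flip: sum_of_nat_int)
    finally show ?thesis .
  qed
  then show ?thesis
    unfolding assoc_mult_mat[OF dims] by (intro eq_matI) (auto simp: A_mat_def gamma_mat_def)
qed

end
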